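(* Let $a\neq0$ be a real number. For integers $n,m\ge0$, with $C^a_{n,m,x}=\det\left(c^a_{m+j-1}(x+i-1)\right)_{i,j=1}^n$, we have $$C^a_{n,m,x}=(-1)^{nm}\,C^{-a}_{m,n,-x}.$$ Moreover, for all integers $n,k,m\ge0$, $$\frac{\det\left(\hat c^{a}_{k+j-1}(m+i-1)\right)_{i,j=1}^n}{(-a)^{nk}\prod_{j=2}^{n-1}j!}=\frac{\det\left(\hat c^{-a}_{n+j-1}(-k+i-1)\right)_{i,j=1}^m}{a^{nm}\prod_{j=2}^{m-1}j!}.$$
   Context: The monic Charlier polynomials with parameter $a\ne0$ are $$\hat c_n^a(x)=\sum_{j=0}^n(-a)^{n-j}\binom nj\binom xj j!,$$ and $c_n^a(x)=\hat c_n^a(x)/n!$ for $n\ge0$. Here $\binom{x}{j}=x(x-1)\cdots(x-j+1)/j!$. A $0\times0$ determinant equals $1$ and an empty product equals $1$. The first identity is an identity of polynomials in $x$. *)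

theory Defs
  imports "Jordan_Normal_Form.Determinant"
begin

definition binom_poly :: "nat \<Rightarrow> real poly" where
  "binom_poly j = smult (1 / fact j) (\<Prod>i<j. [:- of_nat i, 1:])"

lemma poly_binom_poly: "poly (binom_poly j) x = x gchoose j"
  by (simp add: binom_poly_def gbinomial_prod_rev poly_prod atLeast0LessThan)

definition monic_charlier :: "real \<Rightarrow> nat \<Rightarrow> real poly" where
  "monic_charlier a n =
     (\<Sum>j\<le>n. smult ((- a) ^ (n - j) * of_nat (n choose j) * fact j) (binom_poly j))"

lemma poly_monic_charlier:
  "poly (monic_charlier a n) x =
     (\<Sum>j\<le>n. (- a) ^ (n - j) * of_nat (n choose j) * (x gchoose j) * fact j)"
  by (simp add: monic_charlier_def poly_sum poly_binom_poly mult_ac)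

definition charlier :: "real \<Rightarrow> nat \<Rightarrow> real poly" where
  "charlier a n = smult (1 / fact n) (monic_charlier a n)"

text \<open>
  The determinant is a polynomial in the variable \<open>x\<close>. Matrix indices start at 0 in the
  library, so the entry in row \<open>i\<close> and column \<open>j\<close> is the polynomial \<open>charlier a (m + j)\<close>
  with \<open>x + i\<close> substituted for \<open>x\<close>.
\<close>
definition charlier_det :: "real \<Rightarrow> nat \<Rightarrow> nat \<Rightarrow> real poly" where
  "charlier_det a n m =
     det (mat n n (\<lambda>(i, j). pcompose (charlier a (m + j)) [:of_nat i, 1:]))"

end

theory Submission
  imports Defs "HOL-Computational_Algebra.Formal_Power_Series"
begin

text \<open>
  The polynomials \<open>charlier a n\<close> have the generating function \<open>(1 + t) powr x * exp (- a t)\<close>. A unit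
  shift in \<open>x\<close> multiplies this series by \<open>1 + t\<close>, so row operations turn \<open>charlier_det a n m\<close> into
  the Toeplitz determinant of order \<open>n\<close> with diagonal entries \<open>charlier a m\<close>. The series for
  \<open>(- a, - x)\<close> is the inverse of the one for \<open>(a, x)\<close>, so the first identity is Jacobi's relation
  between complementary minors of two inverse unitriangular Toeplitz matrices. The second identity
  combines it with the self-duality of \<open>monic_charlier\<close> in degree and argument, which exchanges
  the roles of \<open>k\<close> and \<open>m\<close>.
\<close>

section \<open>Minors of Toeplitz matrices of inverse power series\<close>

text \<open>The offset \<open>m\<close> selects columns: for offset 0 the matrix is upper
  triangular, and offset \<open>m\<close> gives its columns from \<open>m\<close> on. The guard
  avoids truncated subtraction.\<close>

definition toeplitz_entry :: "'a::zero fps \<Rightarrow> nat \<Rightarrow> nat \<Rightarrow> nat \<Rightarrow> 'a" where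
  "toeplitz_entry f m i j = (if i \<le> m + j then fps_nth f (m + j - i) else 0)"

text \<open>Cutting off at \<open>N\<close> loses nothing: only indices \<open>l\<close> with
  \<open>i \<le> l \<le> j\<close> contribute, and they form the Cauchy product.\<close>

lemma toeplitz_entry_mult:
  fixes f g :: "'a::comm_ring_1 fps"
  assumes "i < N" "j < N"
  shows "(\<Sum>l = 0..<N. toeplitz_entry f 0 i l * toeplitz_entry g 0 l j) = toeplitz_entry (f * g) 0 i j"
proof (cases "i \<le> j")
  case True
  have "(\<Sum>l = 0..<N. toeplitz_entry f 0 i l * toeplitz_entry g 0 l j)
      = (\<Sum>l = 0 + i..(j - i) + i. fps_nth f (l - i) * fps_nth g (j - l))"
    using assms True by (intro sum.mono_neutral_cong_right) (auto simp: toeplitz_entry_def)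
  also have "\<dots> = fps_nth (f * g) (j - i)"
    unfolding sum.shift_bounds_cl_nat_ivl fps_mult_nth
    by (intro sum.cong) (auto simp: diff_diff_add add.commute)
  finally show ?thesis using True by (simp add: toeplitz_entry_def)
next
  case False
  then show ?thesis by (auto simp: toeplitz_entry_def intro!: sum.neutral)
qed

lemma det_toeplitz_unitriangular:
  fixes f :: "'a::comm_ring_1 fps"
  assumes "fps_nth f 0 = 1"
  shows "det (mat N N (\<lambda>(i, j). toeplitz_entry f 0 i j)) = 1"
proof -
  have "upper_triangular (mat N N (\<lambda>(i, j). toeplitz_entry f 0 i j))"
    by (auto simp: toeplitz_entry_def)
  then show ?thesis
    by (subst det_upper_triangular[of _ N])
      (auto simp: prod_list_diag_prod toeplitz_entry_def assms)
qed

text \<open>The determinant of one auxiliary matrix \<open>K\<close> is computed twice: multiplying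
  by the unitriangular \<open>T\<close> of \<open>f\<close> exposes the minor of \<open>f\<close>,
  while moving rows exposes that of \<open>g\<close>.\<close>

lemma det_toeplitz_complementary:
  fixes f g :: "'a::idom fps"
  assumes fg: "f * g = 1" and f0: "fps_nth f 0 = 1"
  shows "det (mat n n (\<lambda>(i, j). toeplitz_entry f m i j))
    = (- 1) ^ (n * m) * det (mat m m (\<lambda>(i, j). toeplitz_entry g n i j))"
proof -
  let ?N = "n + m"
  let ?B = "mat n n (\<lambda>(i, j). toeplitz_entry f m i j)"
  let ?Q = "mat m m (\<lambda>(i, j). toeplitz_entry g n i j)"
  define T where "T = mat ?N ?N (\<lambda>(i, j). toeplitz_entry f 0 i j)"
  \<comment> \<open>The first \<open>n\<close> columns are unit vectors, chosen so that
    \<open>T\<close> maps them to its own last \<open>n\<close> columns; the last \<open>m\<close>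
    columns are those of the inverse of \<open>T\<close>.\<close>
  define K where "K = mat ?N ?N (\<lambda>(i, j).
    if j < n then (if i = m + j then 1 else 0) else toeplitz_entry g 0 i j)"
  define D where "D = mat m n (\<lambda>(i, j). toeplitz_entry f 0 (n + i) (m + j))"
  define S where "S = mat n m (\<lambda>(i, j). toeplitz_entry g 0 (m + i) (n + j))"
  have TK: "T * K = four_block_mat ?B (0\<^sub>m n m) D (1\<^sub>m m)"
  proof (intro eq_matI)
    fix i j
    assume "i < dim_row (four_block_mat ?B (0\<^sub>m n m) D (1\<^sub>m m))"
      and "j < dim_col (four_block_mat ?B (0\<^sub>m n m) D (1\<^sub>m m))"
    then have ij: "i < ?N" "j < ?N" by (auto simp: D_def)
    have TK_eq: "(T * K) $$ (i, j) = (\<Sum>l = 0..<?N. toeplitz_entry f 0 i l * K $$ (l, j))"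
      using ij by (simp add: T_def K_def scalar_prod_def)
    show "(T * K) $$ (i, j) = four_block_mat ?B (0\<^sub>m n m) D (1\<^sub>m m) $$ (i, j)"
    proof (cases "j < n")
      case True
      have "(T * K) $$ (i, j) = (\<Sum>l = 0..<?N. if l = m + j then toeplitz_entry f 0 i l else 0)"
        unfolding TK_eq using ij True by (intro sum.cong) (auto simp: K_def)
      also have "\<dots> = toeplitz_entry f 0 i (m + j)"
        using True by (subst sum.delta) auto
      finally show ?thesis using ij True by (auto simp: D_def toeplitz_entry_def)
    next
      case False
      have "(T * K) $$ (i, j)
          = (\<Sum>l = 0..<?N. toeplitz_entry f 0 i l * toeplitz_entry g 0 l j)"
        unfolding TK_eq using ij False by (intro sum.cong) (auto simp: K_def)
      also have "\<dots> = toeplitz_entry 1 0 i j"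
        using ij by (simp add: toeplitz_entry_mult fg)
      finally show ?thesis using ij False by (auto simp: D_def toeplitz_entry_def)
    qed
  qed (auto simp: T_def K_def D_def)
  \<comment> \<open>Moving the last \<open>n\<close> rows to the top turns the unit columns into an
    identity block; the \<open>n * m\<close> transpositions of adjacent rows give the sign.\<close>
  have swapped: "mat ?N ?N (\<lambda>(i, j). K $$ ((if i < n then i + m else i - n), j))
      = four_block_mat (1\<^sub>m n) S (0\<^sub>m m n) ?Q"
    by (intro eq_matI) (auto simp: K_def S_def toeplitz_entry_def add.commute)
  have "det ?B = det (T * K)"
    unfolding TK by (subst det_four_block_mat_upper_right_zero[where n = n and m = m])
      (auto simp: D_def)
  also have "\<dots> = det K"
    using det_toeplitz_unitriangular[OF f0]
    by (subst det_mult[where n = ?N]) (auto simp: T_def K_def)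
  also have "\<dots> = (- 1) ^ (n * m) * det (four_block_mat (1\<^sub>m n) S (0\<^sub>m m n) ?Q)"
    unfolding swapped[symmetric] by (rule det_swap_rows) (auto simp: K_def)
  also have "\<dots> = (- 1) ^ (n * m) * det ?Q"
    by (subst det_four_block_mat_lower_left_zero[where n = n and m = m]) (auto simp: S_def)
  finally show ?thesis .
qed

text \<open>In the Leibniz expansion a permutation only reorders the column factors, so the same
  scalar leaves every term.\<close>

lemma det_scale_rows_cols:
  fixes r s :: "nat \<Rightarrow> 'a::comm_ring_1"
  shows "det (mat n n (\<lambda>(i, j). r i * A i j * s j))
    = (\<Prod>i<n. r i) * (\<Prod>j<n. s j) * det (mat n n (\<lambda>(i, j). A i j))"
proof -
  have scale: "(\<Prod>i = 0..<n. r i * A i (p i) * s (p i))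
      = (\<Prod>i<n. r i) * (\<Prod>j<n. s j) * (\<Prod>i = 0..<n. A i (p i))"
    if p: "p permutes {0..<n}" for p
  proof -
    have "(\<Prod>i = 0..<n. s (p i)) = (\<Prod>j<n. s j)"
      using prod.permute[OF p, of s] by (simp add: o_def atLeast0LessThan)
    then show ?thesis
      by (simp add: prod.distrib atLeast0LessThan mult_ac)
  qed
  have lt: "p i < n" if "p permutes {0..<n}" "i < n" for p i
    using permutes_in_image[OF that(1), of i] that(2) by simp
  show ?thesis
    unfolding det_def'[OF mat_carrier] sum_distrib_left
    by (intro sum.cong refl) (simp add: lt scale)
qed

section \<open>Generating function and the first identity\<close>

definition charlier_fps :: "real \<Rightarrow> real \<Rightarrow> real fps" where
  "charlier_fps a x = fps_binomial x * fps_exp (- a)"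

lemma charlier_fps_nth: "fps_nth (charlier_fps a x) n = poly (charlier a n) x"
proof -
  have "fps_nth (charlier_fps a x) n = (\<Sum>j\<le>n. (x gchoose j) * ((- a) ^ (n - j) / fact (n - j)))"
    by (simp add: charlier_fps_def fps_mult_nth atLeast0AtMost)
  also have "\<dots> = poly (charlier a n) x"
    unfolding charlier_def poly_smult poly_monic_charlier sum_distrib_left
    by (intro sum.cong) (auto simp: binomial_fact)
  finally show ?thesis .
qed

lemma charlier_fps_add: "charlier_fps a (x + y) = fps_binomial y * charlier_fps a x"
  by (simp add: charlier_fps_def fps_binomial_add_mult mult_ac)

lemma charlier_fps_uminus: "charlier_fps a x * charlier_fps (- a) (- x) = 1"
proof -
  have "charlier_fps a x * charlier_fps (- a) (- x)
      = (fps_binomial x * fps_binomial (- x)) * (fps_exp (- a) * fps_exp a)"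
    by (simp add: charlier_fps_def mult_ac)
  also have "\<dots> = 1"
    by (simp add: fps_binomial_add_mult[symmetric] fps_exp_add_mult[symmetric])
  finally show ?thesis .
qed

text \<open>Coefficients of \<open>charlier_fps a x\<close> multiplied by the \<open>i\<close>-th
  power of \<open>1 + t\<close>.\<close>

lemma poly_charlier_add:
  "poly (charlier a N) (x + real i)
    = (\<Sum>l = 0..N. of_nat (i choose l) * poly (charlier a (N - l)) x)"
  unfolding charlier_fps_nth[symmetric] charlier_fps_add
  by (simp add: fps_mult_nth binomial_gbinomial)

lemma det_charlier_eq_toeplitz:
  "det (mat n n (\<lambda>(i, j). poly (charlier a (m + j)) (x + real i)))
    = det (mat n n (\<lambda>(i, j). toeplitz_entry (charlier_fps a x) m i j))"
proof -
  \<comment> \<open>\<open>L\<close> is a Pascal matrix, unit lower triangular, and carries out all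
    row operations at once.\<close>
  define L where "L = mat n n (\<lambda>(i, l). real (i choose l))"
  define H where "H = mat n n (\<lambda>(i, j). toeplitz_entry (charlier_fps a x) m i j)"
  have "mat n n (\<lambda>(i, j). poly (charlier a (m + j)) (x + real i)) = L * H"
  proof (intro eq_matI)
    fix i j
    assume "i < dim_row (L * H)" "j < dim_col (L * H)"
    then have ij: "i < n" "j < n" by (auto simp: L_def H_def)
    \<comment> \<open>Terms with \<open>l > i\<close> vanish through the binomial coefficient, those
      with \<open>l > m + j\<close> through \<open>toeplitz_entry\<close>; hence both index ranges
      reduce to the intersection.\<close>
    have "poly (charlier a (m + j)) (x + real i)
        = (\<Sum>l \<in> {..i} \<inter> {..m + j}. real (i choose l) * poly (charlier a (m + j - l)) x)"
      unfolding poly_charlier_add by (intro sum.mono_neutral_right) auto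
    also have "\<dots> = (\<Sum>l = 0..<n. real (i choose l) * toeplitz_entry (charlier_fps a x) m l j)"
      using ij by (intro sum.mono_neutral_cong_left)
        (auto simp: toeplitz_entry_def charlier_fps_nth)
    also have "\<dots> = (L * H) $$ (i, j)"
      using ij by (simp add: L_def H_def scalar_prod_def)
    finally show "mat n n (\<lambda>(i, j). poly (charlier a (m + j)) (x + real i)) $$ (i, j)
        = (L * H) $$ (i, j)"
      using ij by simp
  qed (auto simp: L_def H_def)
  moreover have "det L = 1"
    by (subst det_lower_triangular[of n]) (auto simp: L_def prod_list_diag_prod)
  ultimately show ?thesis
    by (simp add: det_mult[where n = n] L_def H_def)
qed

lemma poly_charlier_det:
  "poly (charlier_det a n m) x = det (mat n n (\<lambda>(i, j). poly (charlier a (m + j)) (x + real i)))"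
proof -
  interpret eval: comm_ring_hom "\<lambda>p. poly p x" by unfold_locales auto
  show ?thesis
    unfolding charlier_det_def eval.hom_det[symmetric]
    by (intro arg_cong[where f = det] eq_matI) (auto simp: poly_pcompose add.commute)
qed

lemma poly_charlier_det_dual:
  "poly (charlier_det a n m) x = (- 1) ^ (n * m) * poly (charlier_det (- a) m n) (- x)"
proof -
  have "fps_nth (charlier_fps a x) 0 = 1"
    by (simp add: charlier_fps_def)
  then show ?thesis
    unfolding poly_charlier_det det_charlier_eq_toeplitz
    by (rule det_toeplitz_complementary[OF charlier_fps_uminus])
qed

section \<open>Self-duality and the second identity\<close>

text \<open>Both sides expand to one sum that is symmetric in \<open>n\<close> and
  \<open>x\<close>.\<close>

lemma monic_charlier_self_dual:
  "(- a) ^ x * poly (monic_charlier a n) (real x) = (- a) ^ n * poly (monic_charlier a x) (real n)"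
proof -
  have expand: "(- a) ^ x * poly (monic_charlier a n) (real x)
      = (\<Sum>j \<in> {..n} \<inter> {..x}. (- a) ^ (n + x - j) * real (n choose j) * real (x choose j) * fact j)"
    for n x
  proof -
    have "(- a) ^ x * poly (monic_charlier a n) (real x)
        = (\<Sum>j\<le>n. (- a) ^ (n + x - j) * real (n choose j) * real (x choose j) * fact j)"
      unfolding poly_monic_charlier sum_distrib_left binomial_gbinomial[symmetric]
      by (intro sum.cong) (auto simp: power_add[symmetric] mult.assoc[symmetric] add.commute)
    also have "\<dots> = (\<Sum>j \<in> {..n} \<inter> {..x}.
        (- a) ^ (n + x - j) * real (n choose j) * real (x choose j) * fact j)"
      by (intro sum.mono_neutral_right) auto
    finally show ?thesis .
  qed
  show ?thesis
    unfolding expand by (simp add: Int_commute add.commute mult_ac)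
qed

lemma poly_monic_charlier_eq: "poly (monic_charlier a n) x = fact n * poly (charlier a n) x"
  by (simp add: charlier_def)

lemma det_monic_charlier:
  "det (mat n n (\<lambda>(i, j). poly (monic_charlier a (m + j)) (x + real i)))
    = (\<Prod>j<n. fact (m + j)) * poly (charlier_det a n m) x"
  using det_scale_rows_cols[of n "\<lambda>_. 1" "\<lambda>i j. poly (charlier a (m + j)) (x + real i)"
      "\<lambda>j. fact (m + j)"]
  by (simp add: poly_monic_charlier_eq poly_charlier_det mult.commute)

text \<open>Entrywise self-duality transposes the matrix and exchanges \<open>k\<close> and
  \<open>m\<close>. Of the extracted powers, those with exponents \<open>i\<close> and
  \<open>j\<close> cancel between rows and columns.\<close>

lemma det_monic_charlier_self_dual:
  assumes "a \<noteq> 0"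
  shows "(- a) ^ (n * m) *
      det (mat n n (\<lambda>(i, j). poly (monic_charlier a (k + j)) (real m + real i)))
    = (- a) ^ (n * k) * (\<Prod>j<n. fact (m + j)) * poly (charlier_det a n m) (real k)"
proof -
  let ?A = "mat n n (\<lambda>(i, j). poly (monic_charlier a (m + j)) (real k + real i))"
  have "poly (monic_charlier a (k + j)) (real m + real i)
      = 1 / (- a) ^ (m + i) * poly (monic_charlier a (m + i)) (real k + real j) * (- a) ^ (k + j)"
    for i j
    using monic_charlier_self_dual[of a "m + i" "k + j"] assms by (simp add: field_simps)
  then have "det (mat n n (\<lambda>(i, j). poly (monic_charlier a (k + j)) (real m + real i)))
      = (\<Prod>i<n. 1 / (- a) ^ (m + i)) * (\<Prod>j<n. (- a) ^ (k + j))
        * det (mat n n (\<lambda>(i, j). poly (monic_charlier a (m + i)) (real k + real j)))"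
    by (simp only: det_scale_rows_cols)
  also have "mat n n (\<lambda>(i, j). poly (monic_charlier a (m + i)) (real k + real j))
      = transpose_mat ?A"
    by (intro eq_matI) auto
  also have "det (transpose_mat ?A) = det ?A"
    by (rule det_transpose) auto
  also have "det ?A = (\<Prod>j<n. fact (m + j)) * poly (charlier_det a n m) (real k)"
    by (rule det_monic_charlier)
  also have "(\<Prod>j<n. (- a) ^ (k + j)) = (- a) ^ (n * k) * (\<Prod>j<n. (- a) ^ j)"
    by (simp add: power_add prod.distrib power_mult[symmetric] mult.commute)
  also have "(\<Prod>i<n. 1 / (- a) ^ (m + i)) = 1 / ((- a) ^ (n * m) * (\<Prod>i<n. (- a) ^ i))"
    by (simp add: prod_dividef power_add prod.distrib power_mult[symmetric] mult.commute)
  finally show ?thesis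
    using assms by (simp add: field_simps)
qed

text \<open>The right-hand side is symmetric in \<open>m\<close> and \<open>n\<close>, which lets
  the factorial quotients of the two orders be compared.\<close>

lemma prod_fact_shift:
  "(\<Prod>i<n. fact (m + i)) * (\<Prod>j<m. fact j)
    = (\<Prod>j<m + n. fact j :: 'a::{semiring_char_0,comm_semiring_1})"
  by (induction n) (auto simp: mult_ac)

text \<open>The extra factors are 0! and 1!; for \<open>n \<le> 2\<close> the left product is
  empty.\<close>

lemma prod_fact_from_2:
  "(\<Prod>j = 2..n - 1. fact j) = (\<Prod>j<n. fact j :: 'a::{semiring_char_0,comm_semiring_1})"
proof (rule prod.mono_neutral_left)
  show "\<forall>i\<in>{..<n} - {2..n - 1}. fact i = (1 :: 'a)"
  proof
    fix i assume "i \<in> {..<n} - {2..n - 1}"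
    then have "i = 0 \<or> i = 1" by auto
    then show "fact i = (1 :: 'a)" by auto
  qed
qed auto

theorem corollary5p1:
  fixes a :: real
  assumes "a \<noteq> 0"
  shows "(\<forall>n m :: nat.
            charlier_det a n m = (- 1) ^ (n * m) * pcompose (charlier_det (- a) m n) [:0, - 1:]) \<and>
         (\<forall>n k m :: nat.
            det (mat n n (\<lambda>(i, j). poly (monic_charlier a (k + j)) (real m + real i)))
              / ((- a) ^ (n * k) * (\<Prod>j = 2..n - 1. fact j)) =
            det (mat m m (\<lambda>(i, j). poly (monic_charlier (- a) (n + j)) (- real k + real i)))
              / (a ^ (n * m) * (\<Prod>j = 2..m - 1. fact j)))"
proof (intro conjI allI)
  fix n m :: nat
  \<comment> \<open>Over the reals, equality at every point gives equality of polynomials.\<close>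
  have "poly (charlier_det a n m) x
      = poly ((- 1) ^ (n * m) * pcompose (charlier_det (- a) m n) [:0, - 1:]) x" for x
    by (simp add: poly_pcompose poly_charlier_det_dual[of a n m x])
  then show "charlier_det a n m = (- 1) ^ (n * m) * pcompose (charlier_det (- a) m n) [:0, - 1:]"
    by (simp add: poly_eq_poly_eq_iff[symmetric] fun_eq_iff)
next
  fix n k m :: nat
  define C where "C = poly (charlier_det a n m) (real k)"
  have "det (mat n n (\<lambda>(i, j). poly (monic_charlier a (k + j)) (real m + real i)))
      / ((- a) ^ (n * k) * (\<Prod>j = 2..n - 1. fact j))
    = (\<Prod>j<n. fact (m + j)) * C / ((- a) ^ (n * m) * (\<Prod>j<n. fact j))"
    using det_monic_charlier_self_dual[OF assms, of n m k] assms
    unfolding prod_fact_from_2 C_def by (simp add: field_simps)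
  also have "\<dots> = (\<Prod>j<m. fact (n + j)) * C / ((- a) ^ (n * m) * (\<Prod>j<m. fact j))"
    using prod_fact_shift[of m n, where 'a = real] prod_fact_shift[of n m, where 'a = real] assms
    by (simp add: field_simps)
  \<comment> \<open>The sign from the first identity at \<open>k\<close> turns the power of
    \<open>- a\<close> into that of \<open>a\<close>.\<close>
  also have "\<dots> = (\<Prod>j<m. fact (n + j)) * poly (charlier_det (- a) m n) (- real k)
      / (a ^ (n * m) * (\<Prod>j<m. fact j))"
    using assms unfolding C_def poly_charlier_det_dual[of a n m "real k"] power_minus[of a]
    by simp
  also have "\<dots> = det (mat m m (\<lambda>(i, j). poly (monic_charlier (- a) (n + j)) (- real k + real i)))
      / (a ^ (n * m) * (\<Prod>j = 2..m - 1. fact j))"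
    unfolding det_monic_charlier prod_fact_from_2 ..
  finally show "det (mat n n (\<lambda>(i, j). poly (monic_charlier a (k + j)) (real m + real i)))
      / ((- a) ^ (n * k) * (\<Prod>j = 2..n - 1. fact j)) =
    det (mat m m (\<lambda>(i, j). poly (monic_charlier (- a) (n + j)) (- real k + real i)))
      / (a ^ (n * m) * (\<Prod>j = 2..m - 1. fact j))" .
qed

end
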